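(* Let $c\in\mathbb{C}$ with $|c|=1$, let $E$ be a complex Banach space, and let $f:[0,\infty)\to E$ be $c$-almost periodic (respectively semi-$c$-periodic). Then $\mathbf{E}f:\mathbb{R}\to E$ is the unique $c$-almost periodic extension (respectively the unique semi-$c$-periodic extension) of $f$ to the whole real axis.
   Context: Let $I=\mathbb{R}$ or $I=[0,\infty)$; $\mathbb{N}=\{1,2,\dots\}$; $\mathbb{S}:=\mathbb{N}$ if $I=[0,\infty)$ and $\mathbb{S}:=\mathbb{Z}$ if $I=\mathbb{R}$. Let $f:I\to E$ be continuous. $f$ is $c$-almost periodic if for each $\epsilon>0$ the set of all $\tau>0$ such that $\|f(t+\tau)-cf(t)\|\le\epsilon$ for all $t\in I$ is relatively dense in $[0,\infty)$, i.e. there exists $l>0$ such that every subinterval of $[0,\infty)$ of length $l$ meets this set. Almost periodic means $c=1$; $AP(I:E)$ is the space of all almost periodic functions $I\to E$ with the sup-norm. $f$ is semi-$c$-periodic if for every $\varepsilon>0$ there exists $p>0$ such that $\|f(x+mp)-c^{m}f(x)\|\le\varepsilon$ for all $m\in\mathbb{S}$ and all $x\in I$. Both $c$-almost periodic and semi-$c$-periodic functions are almost periodic. The translations $[W(t)f](s):=f(t+s)$ ($t,s\ge0$) are surjective isometries of $AP([0,\infty):E)$ (Bart and Goldberg), and they extend to a $C_0$-group $(W(t))_{t\in\mathbb{R}}$ of isometries on $AP([0,\infty):E)$ by $W(-t):=W(t)^{-1}$ for $t>0$. The map $\mathbf{E}:AP([0,\infty):E)\to AP(\mathbb{R}:E)$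 is defined by $[\mathbf{E}f](t):=[W(t)f](0)$, $t\in\mathbb{R}$; it is a linear surjective isometry and $\mathbf{E}f$ is the unique continuous almost periodic extension of $f$ to $\mathbb{R}$. *)

theory Defs
  imports "HOL-Analysis.Analysis" "HOL-Library.FuncSet"
begin

class complex_banach = banach +
  fixes scaleC :: "complex \<Rightarrow> 'a \<Rightarrow> 'a" (infixr "*\<^sub>C" 75)
  assumes scaleC_add_right: "a *\<^sub>C (x + y) = a *\<^sub>C x + a *\<^sub>C y"
    and scaleC_add_left: "(a + b) *\<^sub>C x = a *\<^sub>C x + b *\<^sub>C x"
    and scaleC_scaleC: "a *\<^sub>C (b *\<^sub>C x) = (a * b) *\<^sub>C x"
    and scaleR_scaleC: "r *\<^sub>R x = complex_of_real r *\<^sub>C x"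
    and norm_scaleC: "norm (a *\<^sub>C x) = cmod a * norm x"

instantiation complex :: complex_banach
begin

definition scaleC_complex :: "complex \<Rightarrow> complex \<Rightarrow> complex"
  where "scaleC_complex a x = a * x"

instance
  by standard
    (simp_all add: scaleC_complex_def algebra_simps scaleR_conv_of_real norm_mult)

end

text \<open>
  Functions on a domain \<open>I\<close>, which is either \<open>{0..}\<close> or \<open>UNIV\<close>, are represented as total
  functions on the reals; where equality of functions on \<open>{0..}\<close> matters, they are taken from
  \<open>extensional {0..}\<close>, i.e. they have the fixed value \<open>undefined\<close> off \<open>{0..}\<close>.
\<close>

definition relatively_dense :: "real set \<Rightarrow> bool"
  where "relatively_dense S \<longleftrightarrow> (\<exists>l>0. \<forall>a\<ge>0. S \<inter> {a..a + l} \<noteq> {})"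

definition c_almost_periodic :: "real set \<Rightarrow> complex \<Rightarrow> (real \<Rightarrow> 'a::complex_banach) \<Rightarrow> bool"
  where "c_almost_periodic I c f \<longleftrightarrow> continuous_on I f \<and>
    (\<forall>\<epsilon>>0. relatively_dense {\<tau>. \<tau> > 0 \<and> (\<forall>t\<in>I. norm (f (t + \<tau>) - c *\<^sub>C f t) \<le> \<epsilon>)})"

definition multiple_indices :: "real set \<Rightarrow> int set"
  where "multiple_indices I = (if I = UNIV then UNIV else {1..})"

definition semi_c_periodic :: "real set \<Rightarrow> complex \<Rightarrow> (real \<Rightarrow> 'a::complex_banach) \<Rightarrow> bool"
  where "semi_c_periodic I c f \<longleftrightarrow> continuous_on I f \<and>
    (\<forall>\<epsilon>>0. \<exists>p>0. \<forall>m\<in>multiple_indices I. \<forall>x\<in>I.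
       norm (f (x + of_int m * p) - (c powi m) *\<^sub>C f x) \<le> \<epsilon>)"

definition AP :: "real set \<Rightarrow> (real \<Rightarrow> 'a::complex_banach) set"
  where "AP I = {f \<in> extensional I. c_almost_periodic I 1 f}"

definition translate_half :: "real \<Rightarrow> (real \<Rightarrow> 'a) \<Rightarrow> real \<Rightarrow> 'a"
  where "translate_half t f = restrict (\<lambda>s. f (t + s)) {0..}"

text \<open>
  The translation group on \<open>AP {0..}\<close>. Its members are bijections of \<open>AP {0..}\<close> (Bart and
  Goldberg); for \<open>t < 0\<close> the definition is meaningful only on that space.
\<close>

definition AP_group :: "real \<Rightarrow> (real \<Rightarrow> 'a::complex_banach) \<Rightarrow> real \<Rightarrow> 'a"
  where "AP_group t = (if t \<ge> 0 then translate_half t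
                       else inv_into (AP {0..}) (translate_half (- t)))"

definition AP_extension :: "(real \<Rightarrow> 'a::complex_banach) \<Rightarrow> real \<Rightarrow> 'a"
  where "AP_extension f t = AP_group t f 0"

definition is_unique_extension ::
    "((real \<Rightarrow> 'a) \<Rightarrow> bool) \<Rightarrow> (real \<Rightarrow> 'a) \<Rightarrow> (real \<Rightarrow> 'a) \<Rightarrow> bool"
  where "is_unique_extension P f F \<longleftrightarrow>
    P F \<and> (\<forall>t\<ge>0. F t = f t) \<and> (\<forall>g. P g \<and> (\<forall>t\<ge>0. g t = f t) \<longrightarrow> g = F)"

end

theory Submission
  imports Defs
begin

text \<open>
  The key observation is that a property which an almost periodic function has far to the right
  it has everywhere, because an almost period \<open>\<sigma>\<close> moves any point as far to the right as desired
  while changing the function by arbitrarily little. Two instances carry the proof. An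
  \<open>\<epsilon>\<close>-estimate \<open>\<parallel>g (s + \<tau>) - c g s\<parallel> \<le> \<epsilon>\<close> valid for all large \<open>s\<close> is valid on the
  whole domain (\<open>far_shift_estimate\<close>); and two almost periodic functions that agree for all large
  arguments agree (\<open>eq_if_eventually_eq\<close>). The second follows from the first without any common
  almost periods of two functions: an almost period of \<open>g\<close> is one of \<open>h\<close> far to the right, where
  \<open>g\<close> and \<open>h\<close> coincide, hence it is one of \<open>h\<close> everywhere.

  For \<open>\<bar>c\<bar> = 1\<close> both \<open>c\<close>-almost periodic and semi-\<open>c\<close>-periodic functions are almost periodic,
  since the powers of \<open>c\<close> return close to \<open>1\<close> with bounded gaps and the functions are bounded.
  An almost periodic \<open>f\<close> on the half-line extends to the line as the limit of \<open>f (t + \<tau> n)\<close>, where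
  the \<open>\<tau> n\<close> are almost periods of \<open>f\<close>, better and better and tending to infinity. Translations
  are injective on the almost periodic functions on the half-line by the agreement principle, so
  the inverse translations, and with them \<open>AP_extension\<close>, compute exactly this extension. The
  principle on shift estimates then transfers \<open>c\<close>-almost periodicity and semi-\<open>c\<close>-periodicity
  from \<open>f\<close> to its extension, and the agreement principle gives uniqueness.
\<close>

section \<open>Scalars and powers on the unit circle\<close>

lemma scaleC_one: "1 *\<^sub>C x = (x :: 'a::complex_banach)"
  using scaleR_scaleC[of 1 x] by simp

lemma scaleC_diff_left: "(a - b) *\<^sub>C x = a *\<^sub>C x - b *\<^sub>C (x :: 'a::complex_banach)"
  using scaleC_add_left[of "a - b" b x] by (simp add: algebra_simps)

lemma scaleC_diff_right: "a *\<^sub>C (x - y) = a *\<^sub>C x - a *\<^sub>C (y :: 'a::complex_banach)"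
  using scaleC_add_right[of a "x - y" y] by (simp add: algebra_simps)

text \<open>
  The orbit of \<open>1\<close> under multiplication by \<open>c\<close> is totally bounded, so every \<open>c ^ n\<close> is close to
  one of finitely many \<open>c ^ j\<close>; dividing by \<open>c ^ j\<close> yields a return to \<open>1\<close> within a bounded
  distance from \<open>n\<close>.
\<close>

lemma unit_powers_return_near_one:
  fixes c :: complex
  assumes c: "cmod c = 1" and "\<delta> > 0"
  shows "\<exists>N. \<forall>M. \<exists>m\<in>{M..M + N}. cmod (c ^ m - 1) \<le> \<delta>"
proof -
  let ?O = "range (\<lambda>n. c ^ n)"
  have "bounded ?O"
    by (rule boundedI[of _ 1]) (auto simp: norm_power c)
  then have "compact (closure ?O)"
    by (simp add: compact_closure)
  moreover have "closure ?O \<subseteq> (\<Union>n. ball (c ^ n) \<delta>)"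
    using \<open>\<delta> > 0\<close> by (fastforce simp: closure_approachable dist_commute)
  ultimately obtain J where J: "finite J" "closure ?O \<subseteq> (\<Union>n\<in>J. ball (c ^ n) \<delta>)"
    using compactE_image[of "closure ?O" UNIV "\<lambda>n. ball (c ^ n) \<delta>"] by auto
  define N where "N = Max (insert 0 J)"
  have le_N: "j \<le> N" if "j \<in> J" for j
    using that J(1) by (simp add: N_def)
  show ?thesis
  proof (intro exI allI)
    fix M
    have "c ^ (M + N) \<in> closure ?O"
      by (intro subsetD[OF closure_subset] rangeI)
    then obtain j where j: "j \<in> J" "dist (c ^ j) (c ^ (M + N)) < \<delta>"
      using J(2) by auto
    have "c ^ (M + N) = c ^ j * c ^ (M + N - j)"
      using le_N[OF j(1)] by (simp flip: power_add)
    then have "c ^ (M + N) - c ^ j = c ^ j * (c ^ (M + N - j) - 1)"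
      by (simp add: algebra_simps)
    then have "cmod (c ^ (M + N) - c ^ j) = cmod (c ^ (M + N - j) - 1)"
      by (simp only: norm_mult norm_power c power_one mult_1)
    then have "cmod (c ^ (M + N - j) - 1) = dist (c ^ j) (c ^ (M + N))"
      by (simp add: dist_norm norm_minus_commute)
    then show "\<exists>m\<in>{M..M + N}. cmod (c ^ m - 1) \<le> \<delta>"
      using j(2) le_N[OF j(1)] by (intro bexI[of _ "M + N - j"]) simp_all
  qed
qed

section \<open>Almost periodicity on a half-line or the line\<close>

lemma relatively_dense_mono: "relatively_dense S \<Longrightarrow> S \<subseteq> T \<Longrightarrow> relatively_dense T"
  unfolding relatively_dense_def by blast

lemma relatively_denseI:
  assumes "l > 0" and "\<And>a. a \<ge> 0 \<Longrightarrow> \<exists>\<tau>\<in>S. a \<le> \<tau> \<and> \<tau> \<le> a + l"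
  shows "relatively_dense S"
proof -
  have "S \<inter> {a..a + l} \<noteq> {}" if "a \<ge> 0" for a
    using assms(2)[OF that] by auto
  with assms(1) show ?thesis unfolding relatively_dense_def by blast
qed

lemma relatively_denseE:
  assumes "relatively_dense S"
  obtains l where "l > 0" "\<And>a. a \<ge> 0 \<Longrightarrow> \<exists>\<tau>\<in>S. a \<le> \<tau> \<and> \<tau> \<le> a + l"
proof -
  obtain l where l: "l > 0" "\<forall>a\<ge>0. S \<inter> {a..a + l} \<noteq> {}"
    using assms unfolding relatively_dense_def by blast
  have "\<exists>\<tau>\<in>S. a \<le> \<tau> \<and> \<tau> \<le> a + l" if "a \<ge> 0" for a
  proof -
    have "S \<inter> {a..a + l} \<noteq> {}" using l(2) that by blast
    then show ?thesis by auto
  qed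
  with l(1) show ?thesis by (rule that)
qed

lemma relatively_dense_unbounded:
  assumes "relatively_dense S"
  shows "\<exists>\<tau>\<in>S. \<tau> \<ge> b"
proof -
  obtain l where "\<And>a. a \<ge> 0 \<Longrightarrow> \<exists>\<tau>\<in>S. a \<le> \<tau> \<and> \<tau> \<le> a + l"
    using assms by (rule relatively_denseE) blast
  from this[of "max 0 b"] show ?thesis by auto
qed

lemma c_almost_periodic_large_shift:
  assumes "c_almost_periodic I c f" "\<epsilon> > 0"
  obtains \<tau> where "\<tau> \<ge> b" "\<tau> > 0" "\<And>t. t \<in> I \<Longrightarrow> norm (f (t + \<tau>) - c *\<^sub>C f t) \<le> \<epsilon>"
  using relatively_dense_unbounded[of "{\<tau>. \<tau> > 0 \<and> (\<forall>t\<in>I. norm (f (t + \<tau>) - c *\<^sub>C f t) \<le> \<epsilon>)}" b]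
    assms unfolding c_almost_periodic_def by auto

lemma almost_period:
  assumes "c_almost_periodic I 1 f" "\<epsilon> > 0"
  obtains \<tau> where "\<tau> \<ge> b" "\<tau> > 0" "\<And>t. t \<in> I \<Longrightarrow> norm (f (t + \<tau>) - f t) \<le> \<epsilon>"
  using c_almost_periodic_large_shift[OF assms, of b] by (auto simp: scaleC_one)

lemma c_almost_periodic_cong:
  assumes "c_almost_periodic I c f" and "\<And>t. t \<in> I \<Longrightarrow> g t = f t"
    and "\<And>t \<tau>. t \<in> I \<Longrightarrow> \<tau> \<ge> 0 \<Longrightarrow> t + \<tau> \<in> I"
  shows "c_almost_periodic I c g"
  unfolding c_almost_periodic_def
proof (intro conjI allI impI)
  show "continuous_on I g"
    using assms(1,2) by (simp add: c_almost_periodic_def cong: continuous_on_cong)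
  fix \<epsilon> :: real assume "\<epsilon> > 0"
  with assms(1) show "relatively_dense {\<tau>. \<tau> > 0 \<and> (\<forall>t\<in>I. norm (g (t + \<tau>) - c *\<^sub>C g t) \<le> \<epsilon>)}"
    unfolding c_almost_periodic_def
    by (elim conjE allE impE) (auto elim!: relatively_dense_mono simp: assms(2,3))
qed

lemma c_almost_periodic_subset:
  assumes "c_almost_periodic I c f" "J \<subseteq> I"
  shows "c_almost_periodic J c f"
  using assms unfolding c_almost_periodic_def
  by (blast intro: continuous_on_subset relatively_dense_mono)

lemma c_almost_periodic_UNIV_translate:
  assumes "c_almost_periodic UNIV c f"
  shows "c_almost_periodic UNIV c (\<lambda>s. f (t + s))"
  unfolding c_almost_periodic_def
proof (intro conjI allI impI)
  show "continuous_on UNIV (\<lambda>s. f (t + s))"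
    using assms
    by (auto simp: c_almost_periodic_def intro!: continuous_on_compose2[of UNIV f] continuous_intros)
  fix \<epsilon> :: real assume "\<epsilon> > 0"
  with assms show "relatively_dense
      {\<tau>. \<tau> > 0 \<and> (\<forall>s\<in>UNIV. norm (f (t + (s + \<tau>)) - c *\<^sub>C f (t + s)) \<le> \<epsilon>)}"
    unfolding c_almost_periodic_def
    by (elim conjE allE impE) (auto elim!: relatively_dense_mono simp flip: add.assoc)
qed

lemma semi_c_periodic_imp_continuous_on: "semi_c_periodic I c f \<Longrightarrow> continuous_on I f"
  unfolding semi_c_periodic_def by (erule conjunct1)

lemma semi_c_periodicD:
  assumes "semi_c_periodic I c f" "\<epsilon> > 0"
  shows "\<exists>p>0. \<forall>m\<in>multiple_indices I. \<forall>x\<in>I.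
    norm (f (x + of_int m * p) - (c powi m) *\<^sub>C f x) \<le> \<epsilon>"
  using conjunct2[OF assms(1)[unfolded semi_c_periodic_def]] assms(2) by (elim allE impE)

lemma semi_c_periodic_natD:
  assumes f: "semi_c_periodic I c f" and \<epsilon>: "\<epsilon> > 0"
  shows "\<exists>p>0. \<forall>m\<ge>1. \<forall>x\<in>I. norm (f (x + real m * p) - c ^ m *\<^sub>C f x) \<le> \<epsilon>"
proof -
  from semi_c_periodicD[OF f \<epsilon>] obtain p where "p > 0" and p:
    "\<forall>m\<in>multiple_indices I. \<forall>x\<in>I. norm (f (x + of_int m * p) - c powi m *\<^sub>C f x) \<le> \<epsilon>"
    by blast
  have "norm (f (x + real m * p) - c ^ m *\<^sub>C f x) \<le> \<epsilon>" if "m \<ge> 1" "x \<in> I" for m x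
  proof -
    have "int m \<in> multiple_indices I" using that(1) by (simp add: multiple_indices_def)
    from bspec[OF bspec[OF p this] that(2)] show ?thesis by simp
  qed
  with \<open>p > 0\<close> show ?thesis by blast
qed

text \<open>The half-line and the line are treated together through the two properties they share.\<close>

locale forward_domain =
  fixes I :: "real set"
  assumes nonneg_mem: "t \<ge> 0 \<Longrightarrow> t \<in> I"
    and shift_mem: "t \<in> I \<Longrightarrow> \<tau> \<ge> 0 \<Longrightarrow> t + \<tau> \<in> I"
begin

text \<open>
  The shifts in \<open>S\<close> connect an arbitrary point with a point of a compact interval \<open>{0..l}\<close>, where
  a continuous function is bounded: points beyond \<open>l\<close> are reached from it, negative points are
  moved into it.
\<close>

lemma bounded_if_norm_almost_invariant:
  fixes f :: "real \<Rightarrow> 'a::complex_banach"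
  assumes cont: "continuous_on I f" and S: "relatively_dense S"
    and inv: "\<And>t \<tau>. t \<in> I \<Longrightarrow> \<tau> \<in> S \<Longrightarrow> \<bar>norm (f (t + \<tau>)) - norm (f t)\<bar> \<le> 1"
  shows "\<exists>M>0. \<forall>t\<in>I. norm (f t) \<le> M"
proof -
  obtain l where l: "l > 0" "\<And>a. a \<ge> 0 \<Longrightarrow> \<exists>\<tau>\<in>S. a \<le> \<tau> \<and> \<tau> \<le> a + l"
    using S by (rule relatively_denseE) blast
  have "continuous_on {0..l} f"
    using cont by (rule continuous_on_subset) (auto intro: nonneg_mem)
  then have "bounded (f ` {0..l})"
    by (intro compact_imp_bounded compact_continuous_image) auto
  then obtain B where B: "B > 0" "\<And>t. t \<in> {0..l} \<Longrightarrow> norm (f t) \<le> B"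
    by (auto simp: bounded_pos)
  have "norm (f t) \<le> B + 1" if t: "t \<in> I" for t
  proof -
    consider "t < 0" | "t \<in> {0..l}" | "t > l" by force
    then show ?thesis
    proof cases
      case 1
      then obtain \<tau> where "\<tau> \<in> S" "- t \<le> \<tau>" "\<tau> \<le> - t + l"
        using l(2)[of "- t"] by auto
      then show ?thesis
        using inv[OF t, of \<tau>] B(2)[of "t + \<tau>"] by auto
    next
      case 2
      then show ?thesis using B(2)[of t] by simp
    next
      case 3
      then obtain \<tau> where "\<tau> \<in> S" "t - l \<le> \<tau>" "\<tau> \<le> t"
        using l(2)[of "t - l"] by auto
      then show ?thesis
        using inv[of "t - \<tau>" \<tau>] B(2)[of "t - \<tau>"] by (auto simp: nonneg_mem)
    qed
  qed
  then show ?thesis using B(1) by (intro exI[of _ "B + 1"]) auto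
qed

lemma norm_shift_iterate:
  fixes f :: "real \<Rightarrow> 'a::complex_banach"
  assumes c: "cmod c = 1" and "\<tau> \<ge> 0"
    and \<tau>: "\<And>t. t \<in> I \<Longrightarrow> norm (f (t + \<tau>) - c *\<^sub>C f t) \<le> \<epsilon>" and "t \<in> I"
  shows "norm (f (t + real n * \<tau>) - c ^ n *\<^sub>C f t) \<le> real n * \<epsilon>"
proof (induction n)
  case 0
  then show ?case by (simp add: scaleC_one)
next
  case (Suc n)
  let ?s = "t + real n * \<tau>"
  have "f (t + real (Suc n) * \<tau>) - c ^ Suc n *\<^sub>C f t
      = (f (?s + \<tau>) - c *\<^sub>C f ?s) + c *\<^sub>C (f ?s - c ^ n *\<^sub>C f t)"
    by (simp add: scaleC_diff_right scaleC_scaleC algebra_simps)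
  also have "norm \<dots> \<le> \<epsilon> + real n * \<epsilon>"
    using \<tau>[of ?s] Suc assms by (intro norm_triangle_mono) (auto simp: norm_scaleC shift_mem)
  finally show ?case by (simp add: algebra_simps)
qed

text \<open>
  A shift that almost multiplies \<open>f\<close> by \<open>c\<close>, taken \<open>k\<close> times, almost multiplies it by \<open>c ^ k\<close>,
  and some \<open>c ^ k\<close> is as close to \<open>1\<close> as needed.
\<close>

lemma almost_periodic_if_c_almost_periodic:
  fixes f :: "real \<Rightarrow> 'a::complex_banach"
  assumes c: "cmod c = 1" and f: "c_almost_periodic I c f"
  shows "c_almost_periodic I 1 f"
proof -
  let ?S = "\<lambda>\<epsilon>. {\<tau>. \<tau> > 0 \<and> (\<forall>t\<in>I. norm (f (t + \<tau>) - c *\<^sub>C f t) \<le> \<epsilon>)}"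
  have cont: "continuous_on I f" and S: "\<And>\<epsilon>. \<epsilon> > 0 \<Longrightarrow> relatively_dense (?S \<epsilon>)"
    using f by (auto simp: c_almost_periodic_def)
  have "\<bar>norm (f (t + \<tau>)) - norm (f t)\<bar> \<le> 1" if "t \<in> I" "\<tau> \<in> ?S 1" for t \<tau>
    using that norm_triangle_ineq3[of "f (t + \<tau>)" "c *\<^sub>C f t"] by (force simp: norm_scaleC c)
  with bounded_if_norm_almost_invariant[OF cont S[of 1]]
  obtain M where M: "M > 0" "\<And>t. t \<in> I \<Longrightarrow> norm (f t) \<le> M"
    by auto
  show ?thesis
    unfolding c_almost_periodic_def
  proof (intro conjI allI impI cont)
    fix \<epsilon> :: real assume "\<epsilon> > 0"
    with M(1) have "\<epsilon> / (2 * M) > 0" by simp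
    from unit_powers_return_near_one[OF c this] obtain k
      where k: "k \<ge> 1" "cmod (c ^ k - 1) \<le> \<epsilon> / (2 * M)"
      by (meson atLeastAtMost_iff)
    have "\<epsilon> / (2 * real k) > 0" using \<open>\<epsilon> > 0\<close> k(1) by simp
    from S[OF this] obtain l where l: "l > 0"
      "\<And>a. a \<ge> 0 \<Longrightarrow> \<exists>\<tau>\<in>?S (\<epsilon> / (2 * real k)). a \<le> \<tau> \<and> \<tau> \<le> a + l"
      by (rule relatively_denseE) blast
    let ?T = "{\<tau>. \<tau> > 0 \<and> (\<forall>t\<in>I. norm (f (t + \<tau>) - 1 *\<^sub>C f t) \<le> \<epsilon>)}"
    have T: "real k * \<tau> \<in> ?T" if "\<tau> \<in> ?S (\<epsilon> / (2 * real k))" for \<tau>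
    proof -
      have "norm (f (t + real k * \<tau>) - 1 *\<^sub>C f t) \<le> \<epsilon>" if t: "t \<in> I" for t
      proof -
        have "norm (f (t + real k * \<tau>) - c ^ k *\<^sub>C f t) \<le> real k * (\<epsilon> / (2 * real k))"
          using \<open>\<tau> \<in> ?S _\<close> t by (intro norm_shift_iterate[OF c]) auto
        also have "\<dots> = \<epsilon> / 2" using k(1) by simp
        finally have 1: "norm (f (t + real k * \<tau>) - c ^ k *\<^sub>C f t) \<le> \<epsilon> / 2" .
        have "norm ((c ^ k - 1) *\<^sub>C f t) \<le> \<epsilon> / (2 * M) * M"
          unfolding norm_scaleC using k(2) M t \<open>\<epsilon> > 0\<close> by (intro mult_mono) auto
        then have 2: "norm (c ^ k *\<^sub>C f t - 1 *\<^sub>C f t) \<le> \<epsilon> / 2"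
          using M(1) by (simp add: scaleC_diff_left)
        from norm_triangle_mono[OF 1 2] show ?thesis by simp
      qed
      then show ?thesis using that k(1) by auto
    qed
    show "relatively_dense ?T"
    proof (rule relatively_denseI)
      show "real k * l > 0" using k(1) l(1) by simp
      fix a :: real assume "a \<ge> 0"
      then have "a / real k \<ge> 0" by simp
      from l(2)[OF this] obtain \<tau>
        where \<tau>: "\<tau> \<in> ?S (\<epsilon> / (2 * real k))" "a / real k \<le> \<tau>" "\<tau> \<le> a / real k + l"
        by blast
      have "a \<le> real k * \<tau>" "real k * \<tau> \<le> a + real k * l"
        using \<tau>(2,3) k(1) by (simp_all add: field_simps)
      with T[OF \<tau>(1)] show "\<exists>\<tau>\<in>?T. a \<le> \<tau> \<and> \<tau> \<le> a + real k * l"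
        by blast
    qed
  qed
qed

text \<open>
  Among the multiples \<open>m * p\<close> of a semi-period those with \<open>c ^ m\<close> close to \<open>1\<close> are almost periods,
  and such \<open>m\<close> occur with bounded gaps.
\<close>

lemma almost_periodic_if_semi_c_periodic:
  fixes f :: "real \<Rightarrow> 'a::complex_banach"
  assumes c: "cmod c = 1" and f: "semi_c_periodic I c f"
  shows "c_almost_periodic I 1 f"
proof -
  have cont: "continuous_on I f" using f by (rule semi_c_periodic_imp_continuous_on)
  have multiple_in: "\<exists>m0\<ge>1. a \<le> real m0 * p \<and> real m0 * p \<le> a + p" if "a \<ge> 0" "p > 0" for a p
  proof -
    define n where "n = nat \<lfloor>a / p\<rfloor>"
    have "real n \<le> a / p" "a / p \<le> real n + 1"
      using that unfolding n_def by (auto simp: le_floor_iff)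
    then show ?thesis
      using that by (intro exI[of _ "Suc n"]) (auto simp: field_simps)
  qed
  from semi_c_periodic_natD[OF f zero_less_one] obtain p where p: "p > 0"
    "\<forall>m\<ge>1. \<forall>x\<in>I. norm (f (x + real m * p) - c ^ m *\<^sub>C f x) \<le> 1"
    by blast
  have "\<bar>norm (f (t + \<tau>)) - norm (f t)\<bar> \<le> 1" if "t \<in> I" "\<tau> \<in> {real m * p | m. m \<ge> 1}" for t \<tau>
  proof -
    obtain m where m: "m \<ge> 1" "\<tau> = real m * p" using \<open>\<tau> \<in> _\<close> by blast
    have "norm (f (t + real m * p) - c ^ m *\<^sub>C f t) \<le> 1"
      using p(2) m(1) \<open>t \<in> I\<close> by blast
    then show ?thesis
      using m(2) norm_triangle_ineq3[of "f (t + \<tau>)" "c ^ m *\<^sub>C f t"]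
      by (simp add: norm_scaleC norm_power c)
  qed
  moreover have "relatively_dense {real m * p | m. m \<ge> 1}"
    using multiple_in[OF _ p(1)] by (intro relatively_denseI[OF p(1)]) blast
  ultimately obtain M where M: "M > 0" "\<And>t. t \<in> I \<Longrightarrow> norm (f t) \<le> M"
    using bounded_if_norm_almost_invariant[OF cont] by blast
  show ?thesis
    unfolding c_almost_periodic_def
  proof (intro conjI allI impI cont)
    fix \<epsilon> :: real assume "\<epsilon> > 0"
    from semi_c_periodic_natD[OF f half_gt_zero[OF \<open>\<epsilon> > 0\<close>]] obtain p where p: "p > 0"
      "\<forall>m\<ge>1. \<forall>x\<in>I. norm (f (x + real m * p) - c ^ m *\<^sub>C f x) \<le> \<epsilon> / 2"
      by blast
    have "\<epsilon> / (2 * M) > 0" using M(1) \<open>\<epsilon> > 0\<close> by simp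
    from unit_powers_return_near_one[OF c this] obtain N
      where N: "\<And>m0. \<exists>m\<in>{m0..m0 + N}. cmod (c ^ m - 1) \<le> \<epsilon> / (2 * M)"
      by blast
    let ?T = "{\<tau>. \<tau> > 0 \<and> (\<forall>t\<in>I. norm (f (t + \<tau>) - 1 *\<^sub>C f t) \<le> \<epsilon>)}"
    show "relatively_dense ?T"
    proof (rule relatively_denseI)
      show "(real N + 1) * p > 0" using p(1) by simp
      fix a :: real assume a: "a \<ge> 0"
      obtain m0 where m0: "m0 \<ge> 1" "a \<le> real m0 * p" "real m0 * p \<le> a + p"
        using multiple_in[OF a p(1)] by blast
      obtain m where m: "m0 \<le> m" "m \<le> m0 + N" "cmod (c ^ m - 1) \<le> \<epsilon> / (2 * M)"
        using N[of m0] by auto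
      have "norm (f (t + real m * p) - 1 *\<^sub>C f t) \<le> \<epsilon>" if t: "t \<in> I" for t
      proof -
        have 1: "norm (f (t + real m * p) - c ^ m *\<^sub>C f t) \<le> \<epsilon> / 2"
          using p(2) t m(1) m0(1) le_trans by blast
        have "norm ((c ^ m - 1) *\<^sub>C f t) \<le> \<epsilon> / (2 * M) * M"
          unfolding norm_scaleC using m(3) M t \<open>\<epsilon> > 0\<close> by (intro mult_mono) auto
        then have 2: "norm (c ^ m *\<^sub>C f t - 1 *\<^sub>C f t) \<le> \<epsilon> / 2"
          using M(1) by (simp add: scaleC_diff_left)
        from norm_triangle_mono[OF 1 2] show ?thesis by simp
      qed
      then have "real m * p \<in> ?T" using m0(1) m(1) p(1) by simp
      moreover have "real m0 * p \<le> real m * p" "real m * p \<le> (real m0 + real N) * p"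
        using m(1,2) p(1) by (auto intro!: mult_right_mono simp flip: of_nat_add)
      then have "a \<le> real m * p" "real m * p \<le> a + (real N + 1) * p"
        using m0(2,3) by (simp_all add: algebra_simps)
      ultimately show "\<exists>\<tau>\<in>?T. a \<le> \<tau> \<and> \<tau> \<le> a + (real N + 1) * p"
        by blast
    qed
  qed
qed

section \<open>What holds far to the right holds everywhere\<close>

text \<open>
  An almost period \<open>\<sigma>\<close> of \<open>g\<close> moves \<open>s\<close> beyond \<open>b\<close>, at the price of an arbitrarily small error
  at each of \<open>s\<close> and \<open>s + \<tau>\<close>. On the line the shift \<open>\<tau>\<close> may be negative.
\<close>

lemma far_shift_estimate:
  fixes g :: "real \<Rightarrow> 'a::complex_banach"
  assumes c: "cmod c = 1" and g: "c_almost_periodic I 1 g"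
    and far: "\<And>s. s \<in> I \<Longrightarrow> s \<ge> b \<Longrightarrow> norm (g (s + \<tau>) - c *\<^sub>C g s) \<le> \<epsilon>"
    and s: "s \<in> I" "s + \<tau> \<in> I"
  shows "norm (g (s + \<tau>) - c *\<^sub>C g s) \<le> \<epsilon>"
proof (rule field_le_epsilon)
  fix \<delta> :: real assume "\<delta> > 0"
  then obtain \<sigma> where \<sigma>: "\<sigma> \<ge> b - s" "\<sigma> > 0" "\<And>t. t \<in> I \<Longrightarrow> norm (g (t + \<sigma>) - g t) \<le> \<delta> / 2"
    using almost_period[OF g, of "\<delta> / 2" "b - s"] by auto
  have "norm (g (s + \<tau>) - g (s + \<tau> + \<sigma>)) \<le> \<delta> / 2"
    using \<sigma>(3)[OF s(2)] by (simp add: norm_minus_commute)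
  moreover have "norm (g (s + \<tau> + \<sigma>) - c *\<^sub>C g (s + \<sigma>)) \<le> \<epsilon>"
    using far[of "s + \<sigma>"] \<sigma>(1,2) shift_mem[OF s(1), of \<sigma>] by (simp add: algebra_simps)
  moreover have "norm (c *\<^sub>C g (s + \<sigma>) - c *\<^sub>C g s) \<le> \<delta> / 2"
    using \<sigma>(3)[OF s(1)] by (simp add: norm_scaleC c flip: scaleC_diff_right)
  ultimately show "norm (g (s + \<tau>) - c *\<^sub>C g s) \<le> \<epsilon> + \<delta>"
    by norm
qed

text \<open>
  Far to the right an almost period \<open>\<tau>\<close> of \<open>g\<close> is one of \<open>h\<close>, hence it is one of \<open>h\<close> everywhere.
  A large such \<open>\<tau>\<close> lets both \<open>g s\<close> and \<open>h s\<close> be compared with \<open>g (s + \<tau>) = h (s + \<tau>)\<close>.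
\<close>

lemma eq_if_eventually_eq:
  fixes g h :: "real \<Rightarrow> 'a::complex_banach"
  assumes g: "c_almost_periodic I 1 g" and h: "c_almost_periodic I 1 h"
    and eq: "\<And>s. s \<in> I \<Longrightarrow> s \<ge> b \<Longrightarrow> g s = h s" and s: "s \<in> I"
  shows "g s = h s"
proof -
  have "norm (g s - h s) \<le> 0 + \<epsilon>" if \<epsilon>: "\<epsilon> > 0" for \<epsilon>
  proof -
    obtain \<tau> where \<tau>: "\<tau> \<ge> b - s" "\<tau> > 0" "\<And>t. t \<in> I \<Longrightarrow> norm (g (t + \<tau>) - g t) \<le> \<epsilon> / 2"
      using almost_period[OF g half_gt_zero[OF \<epsilon>], of "b - s"] by blast
    have "norm (h (t + \<tau>) - 1 *\<^sub>C h t) \<le> \<epsilon> / 2" if "t \<in> I" "t \<ge> b" for t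
      using \<tau>(2) \<tau>(3)[of t] eq[of t] eq[of "t + \<tau>"] that by (simp add: scaleC_one shift_mem)
    from far_shift_estimate[OF _ h this, of b s]
    have h_period: "norm (h (s + \<tau>) - h s) \<le> \<epsilon> / 2"
      using s \<tau>(2) by (simp add: scaleC_one shift_mem)
    have "g (s + \<tau>) = h (s + \<tau>)"
      using eq s \<tau>(1,2) by (simp add: shift_mem)
    then have "g s - h s = (h (s + \<tau>) - h s) - (g (s + \<tau>) - g s)"
      by simp
    also have "norm \<dots> \<le> \<epsilon> / 2 + \<epsilon> / 2"
      using norm_triangle_le_diff[OF add_mono[OF h_period \<tau>(3)[OF s]]] .
    finally show ?thesis by simp
  qed
  then have "norm (g s - h s) \<le> 0" by (rule field_le_epsilon)
  then show ?thesis by simp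
qed

end

interpretation half_line: forward_domain "{0..}"
  by standard auto

interpretation line: forward_domain UNIV
  by standard auto

section \<open>The extension from the half-line to the line\<close>

text \<open>
  Two shifts \<open>\<tau> m\<close> and \<open>\<tau> n\<close> of \<open>t\<close> are compared through \<open>t + \<tau> m + \<tau> n\<close>, so \<open>f (t + \<tau> n)\<close> is a
  Cauchy sequence, at a rate that is uniform on every interval bounded below. Hence the limit is
  continuous, and it inherits the almost periods of \<open>f\<close> pointwise.
\<close>

lemma almost_periodic_extension_exists:
  fixes f :: "real \<Rightarrow> 'a::complex_banach"
  assumes f: "c_almost_periodic {0..} 1 f"
  shows "\<exists>F. c_almost_periodic UNIV 1 F \<and> (\<forall>t\<ge>0. F t = f t)"
proof -
  have "\<exists>\<tau>. \<tau> \<ge> real n \<and> \<tau> > 0 \<and> (\<forall>t\<ge>0. norm (f (t + \<tau>) - f t) \<le> inverse (real (Suc n)))" for n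
    by (rule almost_period[OF f, of "inverse (real (Suc n))" "real n"]) auto
  then obtain \<tau> where \<tau>: "\<And>n. \<tau> n \<ge> real n" "\<And>n. \<tau> n > 0"
    "\<And>n t. t \<ge> 0 \<Longrightarrow> norm (f (t + \<tau> n) - f t) \<le> inverse (real (Suc n))"
    by metis
  have shift_nonneg: "t + \<tau> n \<ge> 0" if "real n \<ge> - t" for t n
    using \<tau>(1)[of n] that by linarith
  have ev_nonneg: "\<forall>\<^sub>F n in sequentially. t + \<tau> n \<ge> 0" for t
    using eventually_ge_at_top[of "nat \<lceil>- t\<rceil>"]
    by eventually_elim (auto intro!: shift_nonneg simp: nat_le_iff ceiling_le_iff)
  have inv0: "(\<lambda>n. inverse (real (Suc n))) \<longlonglongrightarrow> 0"
    by (rule LIMSEQ_inverse_real_of_nat)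
  have diff: "dist (f (t + \<tau> m)) (f (t + \<tau> n)) \<le> inverse (real (Suc m)) + inverse (real (Suc n))"
    if "t + \<tau> m \<ge> 0" "t + \<tau> n \<ge> 0" for t m n
    using \<tau>(3)[OF that(1), of n] \<tau>(3)[OF that(2), of m]
    by (simp add: dist_norm algebra_simps) norm
  define F where "F t = lim (\<lambda>n. f (t + \<tau> n))" for t
  have F: "(\<lambda>n. f (t + \<tau> n)) \<longlonglongrightarrow> F t" for t
  proof -
    have "Cauchy (\<lambda>n. f (t + \<tau> n))"
    proof (rule metric_CauchyI)
      fix e :: real assume "e > 0"
      then have "\<forall>\<^sub>F n in sequentially. inverse (real (Suc n)) < e / 2"
        using inv0 by (intro order_tendstoD) auto
      then have "\<forall>\<^sub>F n in sequentially. inverse (real (Suc n)) < e / 2 \<and> t + \<tau> n \<ge> 0"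
        using ev_nonneg[of t] by (rule eventually_conj)
      then obtain K where K: "\<And>n. n \<ge> K \<Longrightarrow> inverse (real (Suc n)) < e / 2 \<and> t + \<tau> n \<ge> 0"
        unfolding eventually_sequentially by blast
      show "\<exists>K. \<forall>m\<ge>K. \<forall>n\<ge>K. dist (f (t + \<tau> m)) (f (t + \<tau> n)) < e"
      proof (intro exI allI impI)
        fix m n assume "m \<ge> K" "n \<ge> K"
        with K[of m] K[of n] diff[of t m n]
        show "dist (f (t + \<tau> m)) (f (t + \<tau> n)) < e" by linarith
      qed
    qed
    then show ?thesis
      unfolding F_def using Cauchy_convergent convergent_LIMSEQ_iff by blast
  qed
  have rate: "dist (f (t + \<tau> n)) (F t) \<le> inverse (real (Suc n))" if "t + \<tau> n \<ge> 0" for t n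
  proof (rule tendsto_le[OF sequentially_bot])
    show "(\<lambda>m. dist (f (t + \<tau> n)) (f (t + \<tau> m))) \<longlonglongrightarrow> dist (f (t + \<tau> n)) (F t)"
      by (intro tendsto_intros F)
    show "(\<lambda>m. inverse (real (Suc n)) + inverse (real (Suc m))) \<longlonglongrightarrow> inverse (real (Suc n))"
      using tendsto_add[OF tendsto_const inv0] by simp
    show "\<forall>\<^sub>F m in sequentially. dist (f (t + \<tau> n)) (f (t + \<tau> m))
        \<le> inverse (real (Suc n)) + inverse (real (Suc m))"
      using ev_nonneg[of t] by eventually_elim (use diff that in blast)
  qed
  have F_eq: "F t = f t" if "t \<ge> 0" for t
  proof (rule LIMSEQ_unique[OF F])
    have "(\<lambda>n. f (t + \<tau> n) - f t) \<longlonglongrightarrow> 0"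
      using \<tau>(3)[OF that] by (intro Lim_null_comparison[OF _ inv0]) auto
    then show "(\<lambda>n. f (t + \<tau> n)) \<longlonglongrightarrow> f t"
      by (simp add: LIM_zero_iff)
  qed
  have cont: "continuous_on UNIV F"
  proof -
    have "isCont F x" for x
    proof -
      let ?U = "{x - 1<..}"
      have nonneg: "\<forall>\<^sub>F n in sequentially. \<forall>t\<in>?U. t + \<tau> n \<ge> 0"
        using ev_nonneg[of "x - 1"] by eventually_elim auto
      have "uniform_limit ?U (\<lambda>n t. f (t + \<tau> n)) F sequentially"
      proof (rule uniform_limitI)
        fix e :: real assume "e > 0"
        then have "\<forall>\<^sub>F n in sequentially. inverse (real (Suc n)) < e"
          using inv0 by (intro order_tendstoD) auto
        with nonneg show "\<forall>\<^sub>F n in sequentially. \<forall>t\<in>?U. dist (f (t + \<tau> n)) (F t) < e"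
          by eventually_elim (use rate in force)
      qed
      moreover have "\<forall>\<^sub>F n in sequentially. continuous_on ?U (\<lambda>t. f (t + \<tau> n))"
        using nonneg
      proof eventually_elim
        case (elim n)
        have "continuous_on {0..} f" using f by (simp add: c_almost_periodic_def)
        then show ?case
          by (rule continuous_on_compose2) (use elim in \<open>auto intro!: continuous_intros\<close>)
      qed
      ultimately have "continuous_on ?U F"
        by (intro uniform_limit_theorem) auto
      then show ?thesis
        by (simp add: continuous_on_eq_continuous_at)
    qed
    then show ?thesis by (simp add: continuous_on_eq_continuous_at)
  qed
  have period: "norm (F (t + \<sigma>) - F t) \<le> \<epsilon>"
    if \<sigma>: "\<sigma> > 0" "\<And>t. t \<ge> 0 \<Longrightarrow> norm (f (t + \<sigma>) - f t) \<le> \<epsilon>" for \<sigma> \<epsilon> t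
  proof (rule tendsto_upperbound[OF _ _ sequentially_bot])
    show "(\<lambda>n. norm (f (t + \<sigma> + \<tau> n) - f (t + \<tau> n))) \<longlonglongrightarrow> norm (F (t + \<sigma>) - F t)"
      by (intro tendsto_intros F)
    show "\<forall>\<^sub>F n in sequentially. norm (f (t + \<sigma> + \<tau> n) - f (t + \<tau> n)) \<le> \<epsilon>"
      using ev_nonneg[of t] by eventually_elim (use \<sigma>(2) in \<open>force simp: algebra_simps\<close>)
  qed
  have "c_almost_periodic UNIV 1 F"
    unfolding c_almost_periodic_def
  proof (intro conjI allI impI cont)
    fix \<epsilon> :: real assume "\<epsilon> > 0"
    then have "relatively_dense {\<tau>. \<tau> > 0 \<and> (\<forall>t\<in>{0..}. norm (f (t + \<tau>) - 1 *\<^sub>C f t) \<le> \<epsilon>)}"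
      using f by (simp add: c_almost_periodic_def)
    then show "relatively_dense {\<tau>. \<tau> > 0 \<and> (\<forall>t\<in>UNIV. norm (F (t + \<tau>) - 1 *\<^sub>C F t) \<le> \<epsilon>)}"
      by (rule relatively_dense_mono) (auto simp: scaleC_one intro: period)
  qed
  then show ?thesis using F_eq by blast
qed

lemma inj_on_translate_half:
  assumes "a \<ge> 0"
  shows "inj_on (translate_half a) (AP {0..} :: (real \<Rightarrow> 'a::complex_banach) set)"
proof (rule inj_onI)
  fix g h :: "real \<Rightarrow> 'a"
  assume gh: "g \<in> AP {0..}" "h \<in> AP {0..}" and eq: "translate_half a g = translate_half a h"
  have far: "g s = h s" if "s \<ge> a" for s
    using fun_cong[OF eq, of "s - a"] that assms by (simp add: translate_half_def)
  have "g s = h s" if "s \<ge> 0" for s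
  proof (rule half_line.eq_if_eventually_eq)
    show "c_almost_periodic {0..} 1 g" "c_almost_periodic {0..} 1 h"
      using gh by (simp_all add: AP_def)
  qed (use that far in simp_all)
  moreover have "g \<in> extensional {0..}" "h \<in> extensional {0..}"
    using gh by (simp_all add: AP_def)
  ultimately show "g = h"
    by (meson atLeast_iff extensionalityI)
qed

text \<open>
  For \<open>t < 0\<close> the half-line restriction of \<open>\<lambda>s. F (t + s)\<close> is almost periodic and is translated by
  \<open>- t\<close> to \<open>f\<close>, so by injectivity it is the value of the inverse translation at \<open>f\<close>.
\<close>

lemma AP_extension_eq:
  fixes f :: "real \<Rightarrow> 'a::complex_banach"
  assumes f: "f \<in> extensional {0..}" and F: "c_almost_periodic UNIV 1 F"
    and eq: "\<And>t. t \<ge> 0 \<Longrightarrow> F t = f t"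
  shows "AP_extension f = F"
proof
  fix t :: real
  show "AP_extension f t = F t"
  proof (cases "t \<ge> 0")
    case True
    then show ?thesis
      by (simp add: AP_extension_def AP_group_def translate_half_def eq)
  next
    case False
    define g where "g = restrict (\<lambda>s. F (t + s)) {0..}"
    have "c_almost_periodic {0..} 1 (\<lambda>s. F (t + s))"
      using c_almost_periodic_UNIV_translate[OF F] by (rule c_almost_periodic_subset) simp
    then have "c_almost_periodic {0..} 1 g"
      by (rule c_almost_periodic_cong) (auto simp: g_def)
    then have g: "g \<in> AP {0..}"
      by (simp add: AP_def g_def)
    have "translate_half (- t) g = f"
      using f False
      by (intro extensionalityI[of _ "{0..}"]) (auto simp: translate_half_def g_def eq)
    then have "inv_into (AP {0..}) (translate_half (- t)) f = g"
      using inv_into_f_f[OF inj_on_translate_half g, of "- t"] False by simp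
    then show ?thesis
      using False by (simp add: AP_extension_def AP_group_def g_def)
  qed
qed

section \<open>Transfer of the two kinds of periodicity\<close>

lemma c_almost_periodic_extend:
  fixes F :: "real \<Rightarrow> 'a::complex_banach"
  assumes c: "cmod c = 1" and F: "c_almost_periodic UNIV 1 F"
    and half: "c_almost_periodic {0..} c F"
  shows "c_almost_periodic UNIV c F"
  unfolding c_almost_periodic_def
proof (intro conjI allI impI)
  show "continuous_on UNIV F" using F by (simp add: c_almost_periodic_def)
  fix \<epsilon> :: real assume "\<epsilon> > 0"
  then have "relatively_dense {\<tau>. \<tau> > 0 \<and> (\<forall>t\<in>{0..}. norm (F (t + \<tau>) - c *\<^sub>C F t) \<le> \<epsilon>)}"
    using half by (simp add: c_almost_periodic_def)
  then show "relatively_dense {\<tau>. \<tau> > 0 \<and> (\<forall>t\<in>UNIV. norm (F (t + \<tau>) - c *\<^sub>C F t) \<le> \<epsilon>)}"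
    by (rule relatively_dense_mono) (auto intro: line.far_shift_estimate[OF c F, of 0])
qed

text \<open>
  On the line the multiples \<open>m * p\<close> with \<open>m \<le> 0\<close> enter as well; for negative \<open>m\<close> the estimate at
  \<open>x\<close> is the one for \<open>- m\<close> at \<open>x + m * p\<close>, multiplied by the unit \<open>c powi m\<close>.
\<close>

lemma semi_c_periodic_extend:
  fixes F :: "real \<Rightarrow> 'a::complex_banach"
  assumes c: "cmod c = 1" and F: "c_almost_periodic UNIV 1 F"
    and half: "semi_c_periodic {0..} c F"
  shows "semi_c_periodic UNIV c F"
  unfolding semi_c_periodic_def
proof (intro conjI allI impI)
  show "continuous_on UNIV F" using F by (simp add: c_almost_periodic_def)
  have unit: "cmod (c powi m) = 1" for m
    by (simp add: norm_power_int c)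
  have "c \<noteq> 0" using c by auto
  fix \<epsilon> :: real assume "\<epsilon> > 0"
  from semi_c_periodicD[OF half this] obtain p where p: "p > 0" "\<forall>m\<in>multiple_indices {0..}. \<forall>x\<in>{0..}.
      norm (F (x + of_int m * p) - c powi m *\<^sub>C F x) \<le> \<epsilon>"
    by blast
  have pos: "norm (F (x + of_int m * p) - c powi m *\<^sub>C F x) \<le> \<epsilon>" if "m \<ge> 1" for m x
  proof (rule line.far_shift_estimate[OF unit F, of 0])
    have "m \<in> multiple_indices {0..}" using that by (simp add: multiple_indices_def)
    then show "norm (F (s + of_int m * p) - c powi m *\<^sub>C F s) \<le> \<epsilon>" if "s \<ge> 0" for s
      using that p(2) by simp
  qed auto
  have "norm (F (x + of_int m * p) - c powi m *\<^sub>C F x) \<le> \<epsilon>" for m x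
  proof -
    consider "m \<ge> 1" | "m = 0" | "- m \<ge> 1" by linarith
    then show ?thesis
    proof cases
      case 1
      then show ?thesis by (rule pos)
    next
      case 2
      then show ?thesis using \<open>\<epsilon> > 0\<close> by (simp add: scaleC_one)
    next
      case 3
      let ?y = "x + of_int m * p"
      have "c powi m * c powi (- m) = 1"
        using \<open>c \<noteq> 0\<close> by (simp flip: power_int_add)
      then have "c powi m *\<^sub>C (F (?y + of_int (- m) * p) - c powi (- m) *\<^sub>C F ?y)
          = c powi m *\<^sub>C F x - F ?y"
        by (simp add: scaleC_diff_right scaleC_scaleC scaleC_one)
      then have "norm (c powi m *\<^sub>C F x - F ?y)
          = norm (F (?y + of_int (- m) * p) - c powi (- m) *\<^sub>C F ?y)"
        by (metis unit norm_scaleC mult_1)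
      also have "\<dots> \<le> \<epsilon>" by (rule pos[OF 3])
      finally show ?thesis by (simp add: norm_minus_commute)
    qed
  qed
  then show "\<exists>p>0. \<forall>m\<in>multiple_indices UNIV. \<forall>x\<in>UNIV.
      norm (F (x + of_int m * p) - c powi m *\<^sub>C F x) \<le> \<epsilon>"
    using p(1) by blast
qed

lemma semi_c_periodic_half_line_cong:
  assumes "semi_c_periodic {0..} c f" and eq: "\<And>t. t \<ge> 0 \<Longrightarrow> g t = f t"
  shows "semi_c_periodic {0..} c g"
  unfolding semi_c_periodic_def
proof (intro conjI allI impI)
  show "continuous_on {0..} g"
    using semi_c_periodic_imp_continuous_on[OF assms(1)] by (rule continuous_on_eq) (simp add: eq)
  fix \<epsilon> :: real assume "\<epsilon> > 0"
  from semi_c_periodicD[OF assms(1) this] obtain p where p: "p > 0" "\<forall>m\<in>multiple_indices {0..}. \<forall>x\<in>{0..}.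
      norm (f (x + of_int m * p) - c powi m *\<^sub>C f x) \<le> \<epsilon>"
    by blast
  \<comment> \<open>Hence the indices on the half-line are positive and the shifted points stay in it.\<close>
  have "{0::real..} \<noteq> UNIV"
    by (metis UNIV_I atLeast_iff neg_0_le_iff_le not_one_le_zero)
  then have "x + of_int m * p \<ge> 0" if "m \<in> multiple_indices {0..}" "x \<ge> 0" for x m
    using that p(1) by (simp add: multiple_indices_def)
  with p show "\<exists>p>0. \<forall>m\<in>multiple_indices {0..}. \<forall>x\<in>{0..}.
      norm (g (x + of_int m * p) - c powi m *\<^sub>C g x) \<le> \<epsilon>"
    by (intro exI[of _ p]) (simp add: eq)
qed

text \<open>
  Any property that transfers to the almost periodic extension and that itself entails almost
  periodicity on the line determines the extension uniquely.
\<close>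

lemma is_unique_extension_AP_extension:
  fixes f :: "real \<Rightarrow> 'a::complex_banach"
  assumes f: "f \<in> extensional {0..}" "c_almost_periodic {0..} 1 f"
    and transfer: "\<And>F. c_almost_periodic UNIV 1 F \<Longrightarrow> (\<And>t. t \<ge> 0 \<Longrightarrow> F t = f t) \<Longrightarrow> P F"
    and AP: "\<And>g. P g \<Longrightarrow> c_almost_periodic UNIV 1 g"
  shows "is_unique_extension P f (AP_extension f)"
proof -
  obtain F where F: "c_almost_periodic UNIV 1 F" "\<And>t. t \<ge> 0 \<Longrightarrow> F t = f t"
    using almost_periodic_extension_exists[OF f(2)] by blast
  have "g = F" if "P g" "\<forall>t\<ge>0. g t = f t" for g
  proof
    show "g s = F s" for s
      by (rule line.eq_if_eventually_eq[OF AP[OF that(1)] F(1), of 0]) (simp_all add: that(2) F(2))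
  qed
  moreover have "P F"
    using F by (rule transfer)
  ultimately have "is_unique_extension P f F"
    unfolding is_unique_extension_def using F(2) by blast
  moreover have "AP_extension f = F"
    using f(1) F by (rule AP_extension_eq)
  ultimately show ?thesis by simp
qed

theorem proposition2p25:
  fixes c :: complex and f :: "real \<Rightarrow> 'a::complex_banach"
  assumes "cmod c = 1" and "f \<in> {0..} \<rightarrow>\<^sub>E UNIV"
  shows "(c_almost_periodic {0..} c f \<longrightarrow>
            is_unique_extension (c_almost_periodic UNIV c) f (AP_extension f)) \<and>
         (semi_c_periodic {0..} c f \<longrightarrow>
            is_unique_extension (semi_c_periodic UNIV c) f (AP_extension f))"
proof -
  have ext: "f \<in> extensional {0..}"
    using assms(2) by (simp add: PiE_def)
  show ?thesis
  proof (intro conjI impI)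
    assume f: "c_almost_periodic {0..} c f"
    show "is_unique_extension (c_almost_periodic UNIV c) f (AP_extension f)"
    proof (rule is_unique_extension_AP_extension[OF ext])
      show "c_almost_periodic {0..} 1 f"
        using assms(1) f by (rule half_line.almost_periodic_if_c_almost_periodic)
      fix F assume F: "c_almost_periodic UNIV 1 F" "\<And>t. t \<ge> 0 \<Longrightarrow> F t = f t"
      have "c_almost_periodic {0..} c F"
        using f by (rule c_almost_periodic_cong) (auto simp: F(2))
      with assms(1) F(1) show "c_almost_periodic UNIV c F"
        by (rule c_almost_periodic_extend)
    qed (rule line.almost_periodic_if_c_almost_periodic[OF assms(1)])
  next
    assume f: "semi_c_periodic {0..} c f"
    show "is_unique_extension (semi_c_periodic UNIV c) f (AP_extension f)"
    proof (rule is_unique_extension_AP_extension[OF ext])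
      show "c_almost_periodic {0..} 1 f"
        using assms(1) f by (rule half_line.almost_periodic_if_semi_c_periodic)
      fix F assume F: "c_almost_periodic UNIV 1 F" "\<And>t. t \<ge> 0 \<Longrightarrow> F t = f t"
      have "semi_c_periodic {0..} c F"
        using f by (rule semi_c_periodic_half_line_cong) (rule F(2))
      with assms(1) F(1) show "semi_c_periodic UNIV c F"
        by (rule semi_c_periodic_extend)
    qed (rule line.almost_periodic_if_semi_c_periodic[OF assms(1)])
  qed
qed

end
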